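(* If $\vdash\varphi$ (i.e., $\emptyset\vdash\varphi$), then for every partial structure ${\cal L}$ there is a $\psi$ such that ${\sf reduce}({\cal L},\varphi)=\psi$ and $\vdash\psi$.
   Context: Predicates are objective or subjective; each has a dual predicate $\overline p$. Atoms are $p(t_1,\ldots,t_n)$, plus special objective atoms $\vec t\not\in S$ ($S$ a finite set of tuples of ground terms). Restrictions: $c ::= p_O(t_1,\ldots,t_n)\mid\vec x\not\in S\mid\top\mid\bot\mid c_1\wedge c_2\mid c_1\vee c_2\mid\exists x.c$ ($p_O$ objective). Formulas: $\varphi ::= P\mid\top\mid\bot\mid\varphi_1\wedge\varphi_2\mid\varphi_1\vee\varphi_2\mid\forall\vec x.(c\supset\varphi)\mid\exists\vec x.(c\wedge\varphi)$. A partial structure ${\cal L}$ is a total function $\rho_{\cal L}$ from ground atoms to $\{{\tt tt},{\tt ff},{\tt uu}\}$ (with $\rho_{\cal L}(\vec t\not\in S)={\tt tt}$ iff $\vec t\notin S$, else ${\tt ff}$); ${\cal L}\models P$ iff $\rho_{\cal L}(P)={\tt tt}$. Substitutions map finitely many variables to ground terms; $\bullet$ is the empty one; $\sigma'\geq\sigma$ means $\sigma'$ extends $\sigma$; $\sigma_1+\sigma_2$ is union; $\sigma\backslash\{x\}$ removes $x$. Each objective predicate $p_O$ has input positions $I(p_O)$ and output positions $O(p_O)$ (all positions of $\vec x\not\in S$ are input). A function ${\tt sat}$ is given: for each ${\cal L}$ and objective atom $P=p_O(t_1,\ldots,t_n)$ with $t_k$ ground for all $k\in I(p_O)$, ${\tt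 sat}({\cal L},P)$ is a finite set of substitutions, each with domain containing $\bigcup_{j\in O(p_O)}\mathrm{fv}(t_j)$, such that for all $\sigma'$ with $\mathrm{dom}(\sigma')\supseteq\mathrm{fv}(P)$, ${\cal L}\models P\sigma'$ iff $\sigma'\geq\sigma$ for some $\sigma\in{\tt sat}({\cal L},P)$; undefined otherwise (for ground $\vec t$, ${\tt sat}({\cal L},\vec t\not\in S)=\{\bullet\}$ if $\vec t\notin S$, else $\{\}$). $\widehat{{\tt sat}}$: $\widehat{{\tt sat}}({\cal L},p_O(\vec t))={\tt sat}({\cal L},p_O(\vec t))$; $\widehat{{\tt sat}}({\cal L},\top)=\{\bullet\}$; $\widehat{{\tt sat}}({\cal L},\bot)=\{\}$; $\widehat{{\tt sat}}({\cal L},c_1\wedge c_2)=\bigcup_{\sigma_1\in\widehat{{\tt sat}}({\cal L},c_1)}\{\sigma_1+\sigma_2:\sigma_2\in\widehat{{\tt sat}}({\cal L},c_2\sigma_1)\}$; $\widehat{{\tt sat}}({\cal L},c_1\vee c_2)=\widehat{{\tt sat}}({\cal L},c_1)\cup\widehat{{\tt sat}}({\cal L},c_2)$; $\widehat{{\tt sat}}({\cal L},\exists x.c)=\{\sigma\backslash\{x\}:\sigma\in\widehat{{\tt sat}}({\cal L},c)\}$; defined only when all constituent calls are. ${\sf reduce}$ (partial): for a ground atom $P$, ${\sf reduce}({\cal L},P)$ is $\top$, $\bot$, $P$ according as $\rho_{\cal L}(P)$ is ${\tt tt}$, ${\tt ff}$, ${\tt uu}$; ${\sf reduce}({\cal L},\top)=\top$,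 ${\sf reduce}({\cal L},\bot)=\bot$; it commutes with $\wedge,\vee$. For $\forall\vec x.(c\supset\varphi')$: let $\{\sigma_1,\ldots,\sigma_n\}=\widehat{{\tt sat}}({\cal L},c)$, $\vec t_i=\sigma_i(\vec x)$, $S=\{\vec t_1,\ldots,\vec t_n\}$, $\psi_i={\sf reduce}({\cal L},\varphi'[\vec t_i/\vec x])$; result $\psi_1\wedge\cdots\wedge\psi_n\wedge\forall\vec x.((c\wedge\vec x\not\in S)\supset\varphi')$. For $\exists\vec x.(c\wedge\varphi')$: result $\psi_1\vee\cdots\vee\psi_n\vee\exists\vec x.((c\wedge\vec x\not\in S)\wedge\varphi')$. Defined only when all constituent calls (and the $\sigma_i(\vec x)$) are defined. Mode judgments: for restrictions, $\chi_I\vdash p_O(t_1,\ldots,t_n):\chi_I\cup\bigcup_{j\in O(p_O)}\mathrm{fv}(t_j)$ provided $\mathrm{fv}(t_k)\subseteq\chi_I$ for all $k\in I(p_O)$; $\chi_I\vdash\top:\chi_I$; $\chi_I\vdash\bot:\chi_I$; if $\chi_I\vdash c_1:\chi$ and $\chi\vdash c_2:\chi_O$ then $\chi_I\vdash c_1\wedge c_2:\chi_O$; if $\chi_I\vdash c_1:\chi_1$ and $\chi_I\vdash c_2:\chi_2$ then $\chi_I\vdash c_1\vee c_2:\chi_1\cap\chi_2$; if $\chi_I\vdash c:\chi_O$ then $\chi_I\vdash\exists x.c:\chi_O\backslash\{x\}$. For formulas, $\chi\vdash p(t_1,\ldots,t_n)$ if $\mathrm{fv}(t_k)\subseteq\chi$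 for all $k$; $\chi\vdash\top$; $\chi\vdash\bot$; $\chi\vdash\varphi_1\wedge\varphi_2$ and $\chi\vdash\varphi_1\vee\varphi_2$ if $\chi\vdash\varphi_1$ and $\chi\vdash\varphi_2$; $\chi\vdash\forall\vec x.(c\supset\varphi)$ and $\chi\vdash\exists\vec x.(c\wedge\varphi)$ if there is $\chi_O$ with $\chi\vdash c:\chi_O$, $\vec x\subseteq\chi_O$, $\mathrm{fv}(c)\subseteq\chi\cup\vec x$, and $\chi_O\vdash\varphi$ (with $\vec x$ fresh). $\vdash\varphi$ abbreviates $\emptyset\vdash\varphi$. *)

theory Defs
  imports "HOL-Library.Finite_Map"
begin

section \<open>Terms, atoms, restrictions, formulas\<close>

text \<open>
  Symbols are variadic: a symbol applied to \<open>n\<close> arguments stands for the \<open>n\<close>-ary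
  symbol of that name.  Ground terms form a type of their own, so that substitutions and the sets
  \<open>S\<close> in \<open>ts \<notin> S\<close> contain ground terms by construction.
\<close>

datatype 'f gtrm = GFn 'f "'f gtrm list"

datatype ('f, 'v) trm = Var 'v | Fn 'f "('f, 'v) trm list"

datatype ('o, 's) pred = Obj 'o | Subj 's

text \<open>
  \<open>'p\<close> is the type of predicates, \<open>'t\<close> the type of argument terms, and
  \<open>'g\<close> the type of ground terms.
\<close>

datatype ('p, 't, 'g) atom = Pred 'p "'t list" | NotIn "'t list" "'g list fset"

type_synonym ('o, 's, 'f) gatom = "(('o, 's) pred, 'f gtrm, 'f gtrm) atom"
type_synonym ('o, 'f, 'v) oatom = "('o, ('f, 'v) trm, 'f gtrm) atom"

datatype ('o, 'f, 'v) restr =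
    RAtom "('o, 'f, 'v) oatom"
  | RTop
  | RBot
  | RConj "('o, 'f, 'v) restr" "('o, 'f, 'v) restr"
  | RDisj "('o, 'f, 'v) restr" "('o, 'f, 'v) restr"
  | REx 'v "('o, 'f, 'v) restr"

text \<open>
  \<open>FAll xs c \<phi>\<close> is \<open>\<forall>xs. (c \<supset> \<phi>)\<close> and \<open>FEx xs c \<phi>\<close> is
  \<open>\<exists>xs. (c \<and> \<phi>)\<close>; \<open>xs\<close> binds in both \<open>c\<close> and \<open>\<phi>\<close>.
\<close>

datatype ('o, 's, 'f, 'v) form =
    FAtom "(('o, 's) pred, ('f, 'v) trm, 'f gtrm) atom"
  | FTop
  | FBot
  | FConj "('o, 's, 'f, 'v) form" "('o, 's, 'f, 'v) form"
  | FDisj "('o, 's, 'f, 'v) form" "('o, 's, 'f, 'v) form"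
  | FAll "'v list" "('o, 'f, 'v) restr" "('o, 's, 'f, 'v) form"
  | FEx "'v list" "('o, 'f, 'v) restr" "('o, 's, 'f, 'v) form"

text \<open>
  Positions are counted from 0; positions not occurring in an argument list are disregarded.
  No law relating a predicate to its dual is imposed.
\<close>

record ('o, 's) signature =
  dual :: "('o, 's) pred \<Rightarrow> ('o, 's) pred"
  inputs :: "'o \<Rightarrow> nat set"
  outputs :: "'o \<Rightarrow> nat set"


section \<open>Free variables, groundness, substitution\<close>

primrec fv_trm :: "('f, 'v) trm \<Rightarrow> 'v set" where
  "fv_trm (Var x) = {x}"
| "fv_trm (Fn f ts) = \<Union> (set (map fv_trm ts))"

primrec fv_atom :: "('p, ('f, 'v) trm, 'g) atom \<Rightarrow> 'v set" where
  "fv_atom (Pred p ts) = (\<Union>t\<in>set ts. fv_trm t)"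
| "fv_atom (NotIn ts S) = (\<Union>t\<in>set ts. fv_trm t)"

primrec fv_restr :: "('o, 'f, 'v) restr \<Rightarrow> 'v set" where
  "fv_restr (RAtom P) = fv_atom P"
| "fv_restr RTop = {}"
| "fv_restr RBot = {}"
| "fv_restr (RConj c1 c2) = fv_restr c1 \<union> fv_restr c2"
| "fv_restr (RDisj c1 c2) = fv_restr c1 \<union> fv_restr c2"
| "fv_restr (REx x c) = fv_restr c - {x}"

primrec in_fv :: "('o, 's) signature \<Rightarrow> ('o, 'f, 'v) oatom \<Rightarrow> 'v set" where
  "in_fv sg (Pred p ts) = (\<Union>k\<in>inputs sg p \<inter> {..<length ts}. fv_trm (ts ! k))"
| "in_fv sg (NotIn ts S) = (\<Union>t\<in>set ts. fv_trm t)"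

primrec out_fv :: "('o, 's) signature \<Rightarrow> ('o, 'f, 'v) oatom \<Rightarrow> 'v set" where
  "out_fv sg (Pred p ts) = (\<Union>k\<in>outputs sg p \<inter> {..<length ts}. fv_trm (ts ! k))"
| "out_fv sg (NotIn ts S) = {}"

primrec trm_of :: "'f gtrm \<Rightarrow> ('f, 'v) trm" where
  "trm_of (GFn f gs) = Fn f (map trm_of gs)"

primrec ground_trm :: "('f, 'v) trm \<Rightarrow> 'f gtrm option" where
  "ground_trm (Var x) = None"
| "ground_trm (Fn f ts) = map_option (GFn f) (those (map ground_trm ts))"

primrec ground_atom ::
  "('p, ('f, 'v) trm, 'f gtrm) atom \<Rightarrow> ('p, 'f gtrm, 'f gtrm) atom option" where
  "ground_atom (Pred p ts) = map_option (Pred p) (those (map ground_trm ts))"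
| "ground_atom (NotIn ts S) = map_option (\<lambda>gs. NotIn gs S) (those (map ground_trm ts))"

type_synonym ('f, 'v) subst = "('v, 'f gtrm) fmap"

primrec subst_trm :: "('f, 'v) subst \<Rightarrow> ('f, 'v) trm \<Rightarrow> ('f, 'v) trm" where
  "subst_trm \<sigma> (Var x) = (case fmlookup \<sigma> x of None \<Rightarrow> Var x | Some g \<Rightarrow> trm_of g)"
| "subst_trm \<sigma> (Fn f ts) = Fn f (map (subst_trm \<sigma>) ts)"

definition subst_atom ::
  "('f, 'v) subst \<Rightarrow> ('p, ('f, 'v) trm, 'f gtrm) atom \<Rightarrow> ('p, ('f, 'v) trm, 'f gtrm) atom" where
  "subst_atom \<sigma> = map_atom id (subst_trm \<sigma>) id"

text \<open>Only ground terms are substituted, so no variable can be captured.\<close>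

primrec subst_restr :: "('f, 'v) subst \<Rightarrow> ('o, 'f, 'v) restr \<Rightarrow> ('o, 'f, 'v) restr" where
  "subst_restr \<sigma> (RAtom P) = RAtom (subst_atom \<sigma> P)"
| "subst_restr \<sigma> RTop = RTop"
| "subst_restr \<sigma> RBot = RBot"
| "subst_restr \<sigma> (RConj c1 c2) = RConj (subst_restr \<sigma> c1) (subst_restr \<sigma> c2)"
| "subst_restr \<sigma> (RDisj c1 c2) = RDisj (subst_restr \<sigma> c1) (subst_restr \<sigma> c2)"
| "subst_restr \<sigma> (REx x c) = REx x (subst_restr (fmdrop x \<sigma>) c)"

primrec subst_form :: "('f, 'v) subst \<Rightarrow> ('o, 's, 'f, 'v) form \<Rightarrow> ('o, 's, 'f, 'v) form" where
  "subst_form \<sigma> (FAtom P) = FAtom (subst_atom \<sigma> P)"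
| "subst_form \<sigma> FTop = FTop"
| "subst_form \<sigma> FBot = FBot"
| "subst_form \<sigma> (FConj \<phi>1 \<phi>2) = FConj (subst_form \<sigma> \<phi>1) (subst_form \<sigma> \<phi>2)"
| "subst_form \<sigma> (FDisj \<phi>1 \<phi>2) = FDisj (subst_form \<sigma> \<phi>1) (subst_form \<sigma> \<phi>2)"
| "subst_form \<sigma> (FAll xs c \<phi>) =
     FAll xs (subst_restr (fmdrop_set (set xs) \<sigma>) c) (subst_form (fmdrop_set (set xs) \<sigma>) \<phi>)"
| "subst_form \<sigma> (FEx xs c \<phi>) =
     FEx xs (subst_restr (fmdrop_set (set xs) \<sigma>) c) (subst_form (fmdrop_set (set xs) \<sigma>) \<phi>)"


section \<open>Partial structures and the function sat\<close>

datatype tv = TT | FF | UU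

type_synonym ('o, 's, 'f) struct = "('o, 's, 'f) gatom \<Rightarrow> tv"

definition partial_structure :: "('o, 's, 'f) struct \<Rightarrow> bool" where
  "partial_structure L \<longleftrightarrow> (\<forall>gs S. L (NotIn gs S) = (if gs |\<notin>| S then TT else FF))"

definition models :: "('o, 's, 'f) struct \<Rightarrow> ('o, 'f, 'v) oatom \<Rightarrow> bool" where
  "models L P \<longleftrightarrow> (\<exists>g. ground_atom (map_atom Obj id id P) = Some g \<and> L g = TT)"

type_synonym ('o, 's, 'f, 'v) sat_fun =
  "('o, 's, 'f) struct \<Rightarrow> ('o, 'f, 'v) oatom \<Rightarrow> ('f, 'v) subst set option"

text \<open>
  The requirement on \<open>sat\<close> at one structure \<open>L\<close>.  It is kept separate for each
  \<open>L\<close> because a structure that makes infinitely many instances of an atom true may admit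
  no finite answer set, so that no \<open>sat\<close> at all could meet it at every structure.
\<close>

definition sat_spec ::
  "('o, 's) signature \<Rightarrow> ('o, 's, 'f, 'v) sat_fun \<Rightarrow> ('o, 's, 'f) struct \<Rightarrow> bool" where
  "sat_spec sg sat L \<longleftrightarrow>
     (\<forall>P. if in_fv sg P = {}
          then \<exists>\<Sigma>. sat L P = Some \<Sigma> \<and> finite \<Sigma> \<and>
                 (\<forall>\<sigma>\<in>\<Sigma>. out_fv sg P \<subseteq> fmdom' \<sigma>) \<and>
                 (\<forall>\<sigma>'. fv_atom P \<subseteq> fmdom' \<sigma>' \<longrightarrow>
                    (models L (subst_atom \<sigma>' P) \<longleftrightarrow> (\<exists>\<sigma>\<in>\<Sigma>. \<sigma> \<subseteq>\<^sub>f \<sigma>')))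
          else sat L P = None) \<and>
     (\<forall>ts gs S. those (map ground_trm ts) = Some gs \<longrightarrow>
        sat L (NotIn ts S) = Some (if gs |\<notin>| S then {fmempty} else {}))"

text \<open>
  Termination measures that ignore atoms (the generic \<open>size\<close> counts the terms inside
  atoms and is changed by substitution).
\<close>

primrec size_r :: "('o, 'f, 'v) restr \<Rightarrow> nat" where
  "size_r (RAtom P) = 0"
| "size_r RTop = 0"
| "size_r RBot = 0"
| "size_r (RConj c1 c2) = Suc (size_r c1 + size_r c2)"
| "size_r (RDisj c1 c2) = Suc (size_r c1 + size_r c2)"
| "size_r (REx x c) = Suc (size_r c)"

primrec size_f :: "('o, 's, 'f, 'v) form \<Rightarrow> nat" where
  "size_f (FAtom P) = 0"
| "size_f FTop = 0"
| "size_f FBot = 0"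
| "size_f (FConj \<phi>1 \<phi>2) = Suc (size_f \<phi>1 + size_f \<phi>2)"
| "size_f (FDisj \<phi>1 \<phi>2) = Suc (size_f \<phi>1 + size_f \<phi>2)"
| "size_f (FAll xs c \<phi>) = Suc (size_f \<phi>)"
| "size_f (FEx xs c \<phi>) = Suc (size_f \<phi>)"

lemma size_r_subst_restr [simp]: "size_r (subst_restr \<sigma> c) = size_r c"
  by (induction c arbitrary: \<sigma>) auto

lemma size_f_subst_form [simp]: "size_f (subst_form \<sigma> \<phi>) = size_f \<phi>"
  by (induction \<phi> arbitrary: \<sigma>) auto


section \<open>The extension of sat to restrictions\<close>

text \<open>
  \<open>None\<close> means undefined.  The union of substitutions is \<open>++\<^sub>f\<close>: since
  \<open>\<sigma>2\<close> answers \<open>c2\<close> after \<open>\<sigma>1\<close> has been applied, the two can disagree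
  only on variables that do not occur in the queried atoms, on which \<open>sat\<close> is not
  constrained; there \<open>\<sigma>2\<close> wins.
\<close>

function sat_hat ::
  "('o, 's, 'f, 'v) sat_fun \<Rightarrow> ('o, 's, 'f) struct \<Rightarrow> ('o, 'f, 'v) restr
     \<Rightarrow> ('f, 'v) subst set option" where
  "sat_hat sat L (RAtom P) = sat L P"
| "sat_hat sat L RTop = Some {fmempty}"
| "sat_hat sat L RBot = Some {}"
| "sat_hat sat L (RConj c1 c2) =
     (case sat_hat sat L c1 of
        None \<Rightarrow> None
      | Some \<Sigma>1 \<Rightarrow>
          if \<forall>\<sigma>1\<in>\<Sigma>1. sat_hat sat L (subst_restr \<sigma>1 c2) \<noteq> None
          then Some (\<Union>\<sigma>1\<in>\<Sigma>1. {\<sigma>1 ++\<^sub>f \<sigma>2 | \<sigma>2. \<sigma>2 \<in> the (sat_hat sat L (subst_restr \<sigma>1 c2))})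
          else None)"
| "sat_hat sat L (RDisj c1 c2) =
     (case (sat_hat sat L c1, sat_hat sat L c2) of
        (Some \<Sigma>1, Some \<Sigma>2) \<Rightarrow> Some (\<Sigma>1 \<union> \<Sigma>2)
      | _ \<Rightarrow> None)"
| "sat_hat sat L (REx x c) = map_option (\<lambda>\<Sigma>. {fmdrop x \<sigma> | \<sigma>. \<sigma> \<in> \<Sigma>}) (sat_hat sat L c)"
  by pat_completeness auto
termination by (relation "measure (\<lambda>(_, _, c). size_r c)") auto


section \<open>The function reduce\<close>

text \<open>
  \<open>answers sat L c xs\<close> is the list of tuples \<open>t1, \<dots>, tn\<close> with
  \<open>ti = \<sigma>i(xs)\<close>, for a fixed but arbitrary enumeration \<open>\<sigma>1, \<dots>, \<sigma>n\<close> of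
  the finite set \<open>sat_hat sat L c\<close>.
\<close>

definition answers ::
  "('o, 's, 'f, 'v) sat_fun \<Rightarrow> ('o, 's, 'f) struct \<Rightarrow> ('o, 'f, 'v) restr \<Rightarrow> 'v list
     \<Rightarrow> 'f gtrm list list option" where
  "answers sat L c xs =
     (case sat_hat sat L c of
        None \<Rightarrow> None
      | Some \<Sigma> \<Rightarrow>
          if finite \<Sigma>
          then those (map (\<lambda>\<sigma>. those (map (fmlookup \<sigma>) xs)) (SOME \<sigma>s. set \<sigma>s = \<Sigma> \<and> distinct \<sigma>s))
          else None)"

definition not_in_restr :: "'v list \<Rightarrow> 'f gtrm list list \<Rightarrow> ('o, 'f, 'v) restr" where
  "not_in_restr xs tss = RAtom (NotIn (map Var xs) (fset_of_list tss))"

function reduce ::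
  "('o, 's, 'f, 'v) sat_fun \<Rightarrow> ('o, 's, 'f) struct \<Rightarrow> ('o, 's, 'f, 'v) form
     \<Rightarrow> ('o, 's, 'f, 'v) form option" where
  "reduce sat L (FAtom P) =
     (case ground_atom P of
        None \<Rightarrow> None
      | Some g \<Rightarrow> Some (case L g of TT \<Rightarrow> FTop | FF \<Rightarrow> FBot | UU \<Rightarrow> FAtom P))"
| "reduce sat L FTop = Some FTop"
| "reduce sat L FBot = Some FBot"
| "reduce sat L (FConj \<phi>1 \<phi>2) =
     (case (reduce sat L \<phi>1, reduce sat L \<phi>2) of
        (Some \<psi>1, Some \<psi>2) \<Rightarrow> Some (FConj \<psi>1 \<psi>2)
      | _ \<Rightarrow> None)"
| "reduce sat L (FDisj \<phi>1 \<phi>2) =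
     (case (reduce sat L \<phi>1, reduce sat L \<phi>2) of
        (Some \<psi>1, Some \<psi>2) \<Rightarrow> Some (FDisj \<psi>1 \<psi>2)
      | _ \<Rightarrow> None)"
| "reduce sat L (FAll xs c \<phi>) =
     (case answers sat L c xs of
        None \<Rightarrow> None
      | Some tss \<Rightarrow>
          map_option
            (\<lambda>\<psi>s. foldr FConj \<psi>s (FAll xs (RConj c (not_in_restr xs tss)) \<phi>))
            (those (map (\<lambda>ts. reduce sat L (subst_form (fmap_of_list (zip xs ts)) \<phi>)) tss)))"
| "reduce sat L (FEx xs c \<phi>) =
     (case answers sat L c xs of
        None \<Rightarrow> None
      | Some tss \<Rightarrow>
          map_option
            (\<lambda>\<psi>s. foldr FDisj \<psi>s (FEx xs (RConj c (not_in_restr xs tss)) \<phi>))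
            (those (map (\<lambda>ts. reduce sat L (subst_form (fmap_of_list (zip xs ts)) \<phi>)) tss)))"
  by pat_completeness auto
termination by (relation "measure (\<lambda>(_, _, \<phi>). size_f \<phi>)") auto



section \<open>Mode judgments\<close>

text \<open>
  Bound variables are named, so the convention that they are chosen fresh becomes the side
  conditions \<open>x \<notin> \<chi>\<^sub>I\<close> and \<open>set xs \<inter> \<chi> = {}\<close>.
\<close>

inductive mode_restr ::
  "('o, 's) signature \<Rightarrow> 'v set \<Rightarrow> ('o, 'f, 'v) restr \<Rightarrow> 'v set \<Rightarrow> bool"
  for sg where
  mode_RAtom: "in_fv sg P \<subseteq> \<chi>\<^sub>I \<Longrightarrow> mode_restr sg \<chi>\<^sub>I (RAtom P) (\<chi>\<^sub>I \<union> out_fv sg P)"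
| mode_RTop: "mode_restr sg \<chi>\<^sub>I RTop \<chi>\<^sub>I"
| mode_RBot: "mode_restr sg \<chi>\<^sub>I RBot \<chi>\<^sub>I"
| mode_RConj: "mode_restr sg \<chi>\<^sub>I c1 \<chi> \<Longrightarrow> mode_restr sg \<chi> c2 \<chi>\<^sub>O
     \<Longrightarrow> mode_restr sg \<chi>\<^sub>I (RConj c1 c2) \<chi>\<^sub>O"
| mode_RDisj: "mode_restr sg \<chi>\<^sub>I c1 \<chi>1 \<Longrightarrow> mode_restr sg \<chi>\<^sub>I c2 \<chi>2
     \<Longrightarrow> mode_restr sg \<chi>\<^sub>I (RDisj c1 c2) (\<chi>1 \<inter> \<chi>2)"
| mode_REx: "mode_restr sg \<chi>\<^sub>I c \<chi>\<^sub>O \<Longrightarrow> x \<notin> \<chi>\<^sub>I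
     \<Longrightarrow> mode_restr sg \<chi>\<^sub>I (REx x c) (\<chi>\<^sub>O - {x})"

inductive mode_form ::
  "('o, 's) signature \<Rightarrow> 'v set \<Rightarrow> ('o, 's, 'f, 'v) form \<Rightarrow> bool"
  for sg where
  mode_FAtom: "fv_atom P \<subseteq> \<chi> \<Longrightarrow> mode_form sg \<chi> (FAtom P)"
| mode_FTop: "mode_form sg \<chi> FTop"
| mode_FBot: "mode_form sg \<chi> FBot"
| mode_FConj: "mode_form sg \<chi> \<phi>1 \<Longrightarrow> mode_form sg \<chi> \<phi>2 \<Longrightarrow> mode_form sg \<chi> (FConj \<phi>1 \<phi>2)"
| mode_FDisj: "mode_form sg \<chi> \<phi>1 \<Longrightarrow> mode_form sg \<chi> \<phi>2 \<Longrightarrow> mode_form sg \<chi> (FDisj \<phi>1 \<phi>2)"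
| mode_FAll: "mode_restr sg \<chi> c \<chi>\<^sub>O \<Longrightarrow> set xs \<subseteq> \<chi>\<^sub>O \<Longrightarrow> fv_restr c \<subseteq> \<chi> \<union> set xs
     \<Longrightarrow> mode_form sg \<chi>\<^sub>O \<phi> \<Longrightarrow> set xs \<inter> \<chi> = {} \<Longrightarrow> mode_form sg \<chi> (FAll xs c \<phi>)"
| mode_FEx: "mode_restr sg \<chi> c \<chi>\<^sub>O \<Longrightarrow> set xs \<subseteq> \<chi>\<^sub>O \<Longrightarrow> fv_restr c \<subseteq> \<chi> \<union> set xs
     \<Longrightarrow> mode_form sg \<chi>\<^sub>O \<phi> \<Longrightarrow> set xs \<inter> \<chi> = {} \<Longrightarrow> mode_form sg \<chi> (FEx xs c \<phi>)"

end

theory Submission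
  imports Defs
begin

text \<open>
  Moding is stable under ground substitution: if \<open>\<chi> \<turnstile> c : \<chi>\<^sub>O\<close>, then removing the domain of
  \<open>\<sigma>\<close> on both sides gives a moding of \<open>c\<sigma>\<close>, and likewise for formulas.  For a
  restriction moded from the empty set, this makes all the calls of \<open>sat_hat\<close> defined, and
  every answer binds all of \<open>\<chi>\<^sub>O\<close>.  In a quantified formula moded from the empty set,
  the output \<open>\<chi>\<^sub>O\<close> is exactly the set of bound variables, so that instantiating these
  leaves a closed well-moded body.
\<close>

lemma those_map_total:
  "\<forall>x\<in>set xs. f x \<noteq> None \<Longrightarrow> those (map f xs) = Some (map (\<lambda>x. the (f x)) xs)"
  by (induction xs) auto

lemma fv_trm_of [simp]: "fv_trm (trm_of g) = {}"
  by (induction g) auto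

lemma fv_subst_trm [simp]: "fv_trm (subst_trm \<sigma> t) = fv_trm t - fmdom' \<sigma>"
  by (induction t) (auto split: option.splits simp: fmlookup_dom'_iff)

lemma fv_subst_atom [simp]: "fv_atom (subst_atom \<sigma> P) = fv_atom P - fmdom' \<sigma>"
  by (cases P) (auto simp: subst_atom_def)

lemma in_fv_subst_atom [simp]: "in_fv sg (subst_atom \<sigma> P) = in_fv sg P - fmdom' \<sigma>"
  by (cases P) (auto simp: subst_atom_def)

lemma out_fv_subst_atom [simp]: "out_fv sg (subst_atom \<sigma> P) = out_fv sg P - fmdom' \<sigma>"
  by (cases P) (auto simp: subst_atom_def)

lemma out_fv_subset: "out_fv sg P \<subseteq> fv_atom P"
  by (cases P) force+

lemma fv_subst_restr [simp]: "fv_restr (subst_restr \<sigma> c) = fv_restr c - fmdom' \<sigma>"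
  by (induction c arbitrary: \<sigma>) auto

lemma ground_trm_closed: "fv_trm t = {} \<Longrightarrow> ground_trm t \<noteq> None"
  by (induction t) (auto simp: those_map_total)

lemma ground_atom_closed: "fv_atom P = {} \<Longrightarrow> \<exists>g. ground_atom P = Some g"
  by (cases P) (simp_all add: those_map_total ground_trm_closed)

text \<open>A ground substitution removes its domain from every set of variables and brings in no
  new ones, so the inclusions demanded by the mode rules survive. The induction needs all \<sigma>
  at once, because \<sigma> shrinks under a binder.\<close>

lemma mode_restr_subst:
  "mode_restr sg \<chi> c \<chi>\<^sub>O \<Longrightarrow>
     mode_restr sg (\<chi> - fmdom' \<sigma>) (subst_restr \<sigma> c) (\<chi>\<^sub>O - fmdom' \<sigma>)"
proof (induction arbitrary: \<sigma> rule: mode_restr.induct)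
  case (mode_RAtom P \<chi>)
  then have "in_fv sg (subst_atom \<sigma> P) \<subseteq> \<chi> - fmdom' \<sigma>" by auto
  from mode_restr.mode_RAtom[OF this] show ?case by (simp add: Un_Diff)
next
  case (mode_REx \<chi> c \<chi>\<^sub>O x)
  \<comment> \<open>On the input side, dropping x from \<sigma> changes nothing because x is fresh
    for \<chi>; on the output side, x is deleted in any case.\<close>
  have "\<chi> - fmdom' (fmdrop x \<sigma>) = \<chi> - fmdom' \<sigma>"
    and out: "\<chi>\<^sub>O - fmdom' (fmdrop x \<sigma>) - {x} = \<chi>\<^sub>O - {x} - fmdom' \<sigma>"
    using mode_REx.hyps by auto
  with mode_REx.IH[of "fmdrop x \<sigma>"]
  have "mode_restr sg (\<chi> - fmdom' \<sigma>) (subst_restr (fmdrop x \<sigma>) c)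
      (\<chi>\<^sub>O - fmdom' (fmdrop x \<sigma>))" by simp
  from mode_restr.mode_REx[OF this, of x] mode_REx.hyps show ?case unfolding out by simp
next
  case (mode_RDisj \<chi> c1 \<chi>1 c2 \<chi>2)
  have "\<chi>1 \<inter> \<chi>2 - fmdom' \<sigma> = (\<chi>1 - fmdom' \<sigma>) \<inter> (\<chi>2 - fmdom' \<sigma>)" by auto
  with mode_restr.mode_RDisj[OF mode_RDisj.IH] show ?case by simp
qed (auto intro: mode_restr.intros)

text \<open>Only output positions of atoms add variables to the context, and these variables occur
  in the atom.\<close>

lemma mode_restr_output: "mode_restr sg \<chi> c \<chi>\<^sub>O \<Longrightarrow> \<chi>\<^sub>O \<subseteq> \<chi> \<union> fv_restr c"
  by (induction rule: mode_restr.induct) (use out_fv_subset in fastforce)+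

text \<open>Shared by both quantifiers, with X the set of bound variables. Since X is disjoint from
  \<chi>, sparing X leaves the input context as under \<sigma>. The output loses only the domain of
  \<tau>, which is the context of the substituted body.\<close>

lemma mode_quantifier_subst:
  assumes "mode_restr sg \<chi> c \<chi>\<^sub>O" "X \<subseteq> \<chi>\<^sub>O" "fv_restr c \<subseteq> \<chi> \<union> X" "X \<inter> \<chi> = {}"
    and \<tau>: "\<tau> = fmdrop_set X \<sigma>"
  shows "mode_restr sg (\<chi> - fmdom' \<sigma>) (subst_restr \<tau> c) (\<chi>\<^sub>O - fmdom' \<tau>)"
    and "X \<subseteq> \<chi>\<^sub>O - fmdom' \<tau>"
    and "fv_restr (subst_restr \<tau> c) \<subseteq> (\<chi> - fmdom' \<sigma>) \<union> X"
    and "X \<inter> (\<chi> - fmdom' \<sigma>) = {}"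
proof -
  have "\<chi> - fmdom' \<tau> = \<chi> - fmdom' \<sigma>" using assms(4) \<tau> by auto
  with mode_restr_subst[OF assms(1), of \<tau>]
  show "mode_restr sg (\<chi> - fmdom' \<sigma>) (subst_restr \<tau> c) (\<chi>\<^sub>O - fmdom' \<tau>)" by simp
qed (use assms in auto)

lemma mode_form_subst:
  "mode_form sg \<chi> \<phi> \<Longrightarrow> mode_form sg (\<chi> - fmdom' \<sigma>) (subst_form \<sigma> \<phi>)"
proof (induction arbitrary: \<sigma> rule: mode_form.induct)
  case (mode_FAll \<chi> c \<chi>\<^sub>O xs \<phi>)
  note q = mode_quantifier_subst[OF mode_FAll.hyps(1-3,5) refl, of \<sigma>]
  show ?case using mode_form.mode_FAll[OF q(1-3) mode_FAll.IH q(4)] by simp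
next
  case (mode_FEx \<chi> c \<chi>\<^sub>O xs \<phi>)
  note q = mode_quantifier_subst[OF mode_FEx.hyps(1-3,5) refl, of \<sigma>]
  show ?case using mode_form.mode_FEx[OF q(1-3) mode_FEx.IH q(4)] by simp
qed (auto intro!: mode_form.intros)

text \<open>The induction is on \<open>size_r\<close> because a conjunction queries
  \<open>subst_restr \<sigma> c2\<close>, which is no subterm but has the size of \<open>c2\<close>.
  At an atom, the empty input context forces \<open>in_fv sg P = {}\<close>, where
  \<open>sat\<close> is defined.\<close>

lemma sat_hat_defined:
  assumes "sat_spec sg sat L" and "mode_restr sg {} c \<chi>"
  shows "\<exists>\<Sigma>. sat_hat sat L c = Some \<Sigma> \<and> finite \<Sigma> \<and> (\<forall>\<sigma>\<in>\<Sigma>. \<chi> \<subseteq> fmdom' \<sigma>)"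
  using assms(2)
proof (induction "size_r c" arbitrary: c \<chi> rule: less_induct)
  case less
  note IH = less.hyps
  from less.prems show ?case
  proof cases
    case (mode_RAtom P)
    then have "\<exists>\<Sigma>. sat L P = Some \<Sigma> \<and> finite \<Sigma> \<and> (\<forall>\<sigma>\<in>\<Sigma>. out_fv sg P \<subseteq> fmdom' \<sigma>)"
      using assms(1) unfolding sat_spec_def by (auto dest!: spec[of _ P])
    with mode_RAtom show ?thesis by simp
  next
    case (mode_RConj c1 \<chi>1 c2)
    then obtain \<Sigma>1 where \<Sigma>1: "sat_hat sat L c1 = Some \<Sigma>1" "finite \<Sigma>1"
        "\<forall>\<sigma>\<in>\<Sigma>1. \<chi>1 \<subseteq> fmdom' \<sigma>"
      using IH[of c1 \<chi>1] by auto
    have "\<exists>\<Sigma>. sat_hat sat L (subst_restr \<sigma> c2) = Some \<Sigma> \<and> finite \<Sigma> \<and>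
        (\<forall>\<sigma>2\<in>\<Sigma>. \<chi> - fmdom' \<sigma> \<subseteq> fmdom' \<sigma>2)" if "\<sigma> \<in> \<Sigma>1" for \<sigma>
    proof -
      \<comment> \<open>An answer to \<open>c1\<close> binds the whole context in which
        \<open>c2\<close> is moded, so the instance of \<open>c2\<close> is moded from the empty set
        again.\<close>
      have "\<chi>1 - fmdom' \<sigma> = {}" using \<Sigma>1 that by auto
      with mode_restr_subst[OF mode_RConj(3), of \<sigma>]
      have "mode_restr sg {} (subst_restr \<sigma> c2) (\<chi> - fmdom' \<sigma>)" by simp
      then show ?thesis using mode_RConj(1) by (intro IH) simp_all
    qed
    then obtain F where F: "\<And>\<sigma>. \<sigma> \<in> \<Sigma>1 \<Longrightarrow> sat_hat sat L (subst_restr \<sigma> c2) = Some (F \<sigma>)"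
        "\<And>\<sigma>. \<sigma> \<in> \<Sigma>1 \<Longrightarrow> finite (F \<sigma>)"
        "\<And>\<sigma> \<sigma>2. \<sigma> \<in> \<Sigma>1 \<Longrightarrow> \<sigma>2 \<in> F \<sigma> \<Longrightarrow> \<chi> - fmdom' \<sigma> \<subseteq> fmdom' \<sigma>2"
      by metis
    let ?\<Sigma> = "\<Union>\<sigma>1\<in>\<Sigma>1. {\<sigma>1 ++\<^sub>f \<sigma>2 | \<sigma>2. \<sigma>2 \<in> F \<sigma>1}"
    have "sat_hat sat L c = Some ?\<Sigma>" using mode_RConj(1) \<Sigma>1 F(1) by simp
    moreover have "finite ?\<Sigma>" using \<Sigma>1 F(2) by auto
    \<comment> \<open>The second answer binds whatever part of \<chi> the first leaves
      unbound.\<close>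
    moreover have "\<forall>\<sigma>\<in>?\<Sigma>. \<chi> \<subseteq> fmdom' \<sigma>" using F(3) by fastforce
    ultimately show ?thesis by blast
  next
    case (mode_RDisj c1 \<chi>1 c2 \<chi>2)
    \<comment> \<open>Each answer stems from one disjunct and binds that disjunct's output, hence
      the intersection.\<close>
    then show ?thesis using IH[of c1 \<chi>1] IH[of c2 \<chi>2] by fastforce
  next
    case (mode_REx c' \<chi>' x)
    then obtain \<Sigma> where "sat_hat sat L c' = Some \<Sigma>" "finite \<Sigma>" "\<forall>\<sigma>\<in>\<Sigma>. \<chi>' \<subseteq> fmdom' \<sigma>"
      using IH[of c' \<chi>'] by auto
    then show ?thesis using mode_REx by fastforce
  qed simp_all
qed

text \<open>The tuple lengths are recorded so that \<open>zip xs ts\<close> later binds every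
  variable of \<open>xs\<close>.\<close>

lemma answers_defined:
  assumes "sat_spec sg sat L" "mode_restr sg {} c \<chi>" "set xs \<subseteq> \<chi>"
  shows "\<exists>tss. answers sat L c xs = Some tss \<and> (\<forall>ts\<in>set tss. length ts = length xs)"
proof -
  obtain \<Sigma> where \<Sigma>: "sat_hat sat L c = Some \<Sigma>" "finite \<Sigma>" "\<forall>\<sigma>\<in>\<Sigma>. \<chi> \<subseteq> fmdom' \<sigma>"
    using sat_hat_defined[OF assms(1,2)] by auto
  define \<sigma>s where "\<sigma>s = (SOME \<sigma>s. set \<sigma>s = \<Sigma> \<and> distinct \<sigma>s)"
  \<comment> \<open>Finiteness of \<Sigma> provides an enumeration for the choice operator to
    pick.\<close>
  have "set \<sigma>s = \<Sigma> \<and> distinct \<sigma>s"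
    unfolding \<sigma>s_def by (rule someI_ex) (rule finite_distinct_list[OF \<Sigma>(2)])
  then have "those (map (fmlookup \<sigma>) xs) = Some (map (\<lambda>x. the (fmlookup \<sigma> x)) xs)"
    if "\<sigma> \<in> set \<sigma>s" for \<sigma>
    using that \<Sigma>(3) assms(3) by (intro those_map_total) (force simp: fmlookup_dom'_iff)
  then have "those (map (\<lambda>\<sigma>. those (map (fmlookup \<sigma>) xs)) \<sigma>s) =
      Some (map (\<lambda>\<sigma>. map (\<lambda>x. the (fmlookup \<sigma> x)) xs) \<sigma>s)"
    by (subst those_map_total) auto
  with \<Sigma> show ?thesis by (auto simp: answers_def \<sigma>s_def)
qed

lemma fmdom'_fmap_of_list_zip:
  "length ts = length xs \<Longrightarrow> fmdom' (fmap_of_list (zip xs ts)) = set xs"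
  by (simp add: fmdom'_alt_def fset_of_list.rep_eq flip: set_map)

lemma mode_quantifier_closed:
  assumes "mode_restr sg {} c \<chi>" "set xs \<subseteq> \<chi>" "fv_restr c \<subseteq> {} \<union> set xs" "mode_form sg \<chi> \<phi>"
  shows "length ts = length xs \<Longrightarrow>
      mode_form sg {} (subst_form (fmap_of_list (zip xs ts)) \<phi>)"
    and "mode_restr sg {} (RConj c (not_in_restr xs tss)) \<chi>"
    and "fv_restr (RConj c (not_in_restr xs tss)) \<subseteq> {} \<union> set xs"
proof -
  \<comment> \<open>The output lies within the empty input together with the free variables of
    \<open>c\<close>, all of which are in \<open>xs\<close>.\<close>
  have "\<chi> = set xs" using mode_restr_output[OF assms(1)] assms(2,3) by auto
  then show "mode_form sg {} (subst_form (fmap_of_list (zip xs ts)) \<phi>)"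
    if "length ts = length xs"
    using mode_form_subst[OF assms(4), of "fmap_of_list (zip xs ts)"] that
    by (simp add: fmdom'_fmap_of_list_zip)
  \<comment> \<open>All positions of the added atom are inputs. As the second conjunct it is moded
    after \<open>c\<close> has bound \<open>xs\<close>, and it leaves the context unchanged, so the
    body keeps its moding.\<close>
  have "mode_restr sg \<chi> (not_in_restr xs tss) \<chi>"
    using mode_RAtom[of sg "NotIn (map Var xs) (fset_of_list tss)" \<chi>] assms(2)
    by (simp add: not_in_restr_def)
  with assms(1) show "mode_restr sg {} (RConj c (not_in_restr xs tss)) \<chi>"
    by (rule mode_RConj)
  show "fv_restr (RConj c (not_in_restr xs tss)) \<subseteq> {} \<union> set xs"
    using assms(3) by (simp add: not_in_restr_def)
qed

lemma mode_form_foldr: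
  assumes "\<forall>\<psi>\<in>set \<psi>s. mode_form sg \<chi> \<psi>" "mode_form sg \<chi> \<phi>"
  shows "mode_form sg \<chi> (foldr FConj \<psi>s \<phi>)" "mode_form sg \<chi> (foldr FDisj \<psi>s \<phi>)"
  using assms by (induction \<psi>s) (auto intro: mode_form.intros)

text \<open>The induction is on \<open>size_f\<close> because the recursive calls are on instances
  of the body, which have the same size as the body. The residual quantified formula is returned
  without being reduced again.\<close>

lemma reduce_total:
  assumes "sat_spec sg sat L" and "mode_form sg {} \<phi>"
  shows "\<exists>\<psi>. reduce sat L \<phi> = Some \<psi> \<and> mode_form sg {} \<psi>"
  using assms(2)
proof (induction "size_f \<phi>" arbitrary: \<phi> rule: less_induct)
  case less
  note IH = less.hyps
  \<comment> \<open>Both quantifiers need the same facts about their instances; they differ only in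
    the connective that joins the results.\<close>
  have instances: "\<exists>tss \<psi>s. answers sat L c xs = Some tss \<and>
      those (map (\<lambda>ts. reduce sat L (subst_form (fmap_of_list (zip xs ts)) \<phi>')) tss) = Some \<psi>s \<and>
      (\<forall>\<psi>\<in>set \<psi>s. mode_form sg {} \<psi>)"
    if prems: "mode_restr sg {} c \<chi>" "set xs \<subseteq> \<chi>" "fv_restr c \<subseteq> {} \<union> set xs" "mode_form sg \<chi> \<phi>'"
      and smaller: "size_f \<phi>' < size_f \<phi>" for c :: "('a, 'c, 'd) restr" and xs \<chi> \<phi>'
  proof -
    obtain tss where tss: "answers sat L c xs = Some tss" "\<forall>ts\<in>set tss. length ts = length xs"
      using answers_defined[OF assms(1) prems(1,2)] by auto
    have "\<exists>\<psi>. reduce sat L (subst_form (fmap_of_list (zip xs ts)) \<phi>') = Some \<psi> \<and> mode_form sg {} \<psi>"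
      if "ts \<in> set tss" for ts
      using tss(2) that smaller mode_quantifier_closed(1)[OF prems] by (intro IH) auto
    then have "\<forall>ts\<in>set tss. \<exists>\<psi>. reduce sat L (subst_form (fmap_of_list (zip xs ts)) \<phi>') = Some \<psi> \<and>
        mode_form sg {} \<psi>" by blast
    \<comment> \<open>The list of results stays schematic until \<open>those_map_total\<close>
      instantiates it.\<close>
    with tss(1) show ?thesis
      by (intro exI conjI) (assumption, rule those_map_total, auto)
  qed
  from less.prems show ?case
  proof cases
    case (mode_FAtom P)
    then obtain g where "ground_atom P = Some g" using ground_atom_closed[of P] by auto
    \<comment> \<open>For the value \<open>UU\<close> the result is the atom itself, moded by
      assumption.\<close>
    with mode_FAtom less.prems show ?thesis by (auto split: tv.split intro: mode_form.intros)
  next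
    case (mode_FConj \<phi>1 \<phi>2)
    then show ?thesis using IH[of \<phi>1] IH[of \<phi>2] by (auto intro: mode_form.intros)
  next
    case (mode_FDisj \<phi>1 \<phi>2)
    then show ?thesis using IH[of \<phi>1] IH[of \<phi>2] by (auto intro: mode_form.intros)
  next
    case (mode_FAll c \<chi> xs \<phi>')
    note q = mode_FAll(2-5)
    obtain tss \<psi>s where "answers sat L c xs = Some tss"
      "those (map (\<lambda>ts. reduce sat L (subst_form (fmap_of_list (zip xs ts)) \<phi>')) tss) = Some \<psi>s"
      "\<forall>\<psi>\<in>set \<psi>s. mode_form sg {} \<psi>"
      using instances[OF q] mode_FAll(1) by auto
    moreover have "mode_form sg {} (FAll xs (RConj c (not_in_restr xs tss)) \<phi>')"
      using mode_quantifier_closed(2,3)[OF q] q by (blast intro: mode_form.mode_FAll)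
    ultimately show ?thesis using mode_FAll(1) by (simp add: mode_form_foldr)
  next
    case (mode_FEx c \<chi> xs \<phi>')
    note q = mode_FEx(2-5)
    obtain tss \<psi>s where "answers sat L c xs = Some tss"
      "those (map (\<lambda>ts. reduce sat L (subst_form (fmap_of_list (zip xs ts)) \<phi>')) tss) = Some \<psi>s"
      "\<forall>\<psi>\<in>set \<psi>s. mode_form sg {} \<psi>"
      using instances[OF q] mode_FEx(1) by auto
    moreover have "mode_form sg {} (FEx xs (RConj c (not_in_restr xs tss)) \<phi>')"
      using mode_quantifier_closed(2,3)[OF q] q by (blast intro: mode_form.mode_FEx)
    ultimately show ?thesis using mode_FEx(1) by (simp add: mode_form_foldr)
  qed (auto intro: mode_form.intros)
qed

theorem mainTheorem10:
  fixes sg :: "('o, 's) signature"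
    and sat :: "('o, 's, 'f, 'v) sat_fun"
    and \<phi> :: "('o, 's, 'f, 'v) form"
  assumes "mode_form sg {} \<phi>"
  shows "\<forall>L. partial_structure L \<and> sat_spec sg sat L \<longrightarrow>
           (\<exists>\<psi>. reduce sat L \<phi> = Some \<psi> \<and> mode_form sg {} \<psi>)"
  using assms reduce_total by blast

end
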